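(* Let $G$ be a connected graph of order $n_1$, and let $H$ be a graph of order $n_2$ and maximum degree $\Delta$. (i) If $\Delta=n_2-1$, then $\dim_s(K_1+H)=\dim_s(H)+1$. (ii) If $H$ has diameter two and either $\Delta\le n_2-2$ or $n_1\ge 2$, then $\dim_s(G\odot H)=(n_1-1)n_2+\dim_s(H)$. (iii) If $H$ is not connected or its diameter is greater than two, then $\dim_s(G\odot H)=(n_1-1)n_2+\dim_s(K_1+H)$.
   Context: All graphs are finite and simple. $K_1$ is the one-vertex graph; the join $A+B$ joins every vertex of $A$ to every vertex of $B$ (disjoint copies). For $G$ with vertices $v_1,\dots,v_{n_1}$, the corona product $G\odot H$ is obtained from $G$ and $n_1$ disjoint copies $H_1,\dots,H_{n_1}$ of $H$ by joining $v_i$ to every vertex of $H_i$. For a connected graph $X$, $I_X[u,v]$ is the set of vertices on some shortest $u$–$v$ path; $w$ strongly resolves $u,v$ if $v\in I_X[u,w]$ or $u\in I_X[v,w]$; a strong resolving set is a set $S$ such that every two distinct vertices are strongly resolved by some vertex of $S$; the strong metric dimension $\dim_s(X)$ is the minimum size of a strong resolving set. *)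

theory Defs
  imports "Graph_Theory.Graph_Theory"
begin

(* Finite simple graphs are the library's "pair_graph": finite, loopless, symmetric digraphs
   whose arcs are pairs of vertices. An undirected edge {u, v} is the pair of arcs (u, v), (v, u),
   so that the degree of a vertex is its out-degree. The locale admits the graph without vertices;
   the predicate Digraph_Component.connected does not. *)

definition max_degree :: "'a pair_pre_digraph \<Rightarrow> nat" where
  "max_degree X = Max (out_degree (with_proj X) ` pverts X)"

(* Every arc has weight 1; the distance is infinite between different components. *)
definition graph_dist :: "'a pair_pre_digraph \<Rightarrow> 'a \<Rightarrow> 'a \<Rightarrow> ereal" where
  "graph_dist X u v = wf_digraph.\<mu> (with_proj X) (\<lambda>_. 1) u v"

definition graph_diameter :: "'a pair_pre_digraph \<Rightarrow> ereal" where
  "graph_diameter X = (SUP u\<in>pverts X. SUP v\<in>pverts X. graph_dist X u v)"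

definition shortest_path :: "'a pair_pre_digraph \<Rightarrow> 'a \<Rightarrow> ('a \<times> 'a) awalk \<Rightarrow> 'a \<Rightarrow> bool" where
  "shortest_path X u p v \<longleftrightarrow>
     pre_digraph.apath (with_proj X) u p v \<and> ereal (real (length p)) = graph_dist X u v"

definition geodesic_interval :: "'a pair_pre_digraph \<Rightarrow> 'a \<Rightarrow> 'a \<Rightarrow> 'a set" where
  "geodesic_interval X u v =
     {w. \<exists>p. shortest_path X u p v \<and> w \<in> set (pre_digraph.awalk_verts (with_proj X) u p)}"

definition strongly_resolves :: "'a pair_pre_digraph \<Rightarrow> 'a \<Rightarrow> 'a \<Rightarrow> 'a \<Rightarrow> bool" where
  "strongly_resolves X w u v \<longleftrightarrow>
     v \<in> geodesic_interval X u w \<or> u \<in> geodesic_interval X v w"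

definition strong_resolving_set :: "'a pair_pre_digraph \<Rightarrow> 'a set \<Rightarrow> bool" where
  "strong_resolving_set X S \<longleftrightarrow> S \<subseteq> pverts X \<and>
     (\<forall>u\<in>pverts X. \<forall>v\<in>pverts X. u \<noteq> v \<longrightarrow> (\<exists>w\<in>S. strongly_resolves X w u v))"

(* Intended for connected graphs. The vertex set is itself strongly resolving there, so the
   minimum is attained. *)
definition strong_metric_dim :: "'a pair_pre_digraph \<Rightarrow> nat" where
  "strong_metric_dim X = (LEAST k. \<exists>S. strong_resolving_set X S \<and> card S = k)"

definition K1 :: "unit pair_pre_digraph" where
  "K1 = \<lparr> pverts = {()}, parcs = {} \<rparr>"

definition graph_join ::
  "'a pair_pre_digraph \<Rightarrow> 'b pair_pre_digraph \<Rightarrow> ('a + 'b) pair_pre_digraph" where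
  "graph_join A B =
     \<lparr> pverts = pverts A <+> pverts B,
       parcs = {(Inl u, Inl v) | u v. (u, v) \<in> parcs A}
             \<union> {(Inr u, Inr v) | u v. (u, v) \<in> parcs B}
             \<union> {(Inl u, Inr v) | u v. u \<in> pverts A \<and> v \<in> pverts B}
             \<union> {(Inr v, Inl u) | u v. u \<in> pverts A \<and> v \<in> pverts B} \<rparr>"

(* Inl g is the vertex g of G; Inr (g, h) is the vertex h of the copy of H attached to g. *)
definition corona ::
  "'a pair_pre_digraph \<Rightarrow> 'b pair_pre_digraph \<Rightarrow> ('a + 'a \<times> 'b) pair_pre_digraph" where
  "corona G H =
     \<lparr> pverts = pverts G <+> (pverts G \<times> pverts H),
       parcs = {(Inl g, Inl g') | g g'. (g, g') \<in> parcs G}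
             \<union> {(Inr (g, h), Inr (g, h')) | g h h'. g \<in> pverts G \<and> (h, h') \<in> parcs H}
             \<union> {(Inl g, Inr (g, h)) | g h. g \<in> pverts G \<and> h \<in> pverts H}
             \<union> {(Inr (g, h), Inl g) | g h. g \<in> pverts G \<and> h \<in> pverts H} \<rparr>"

lemma pair_graph_altdef:
  "pair_graph X \<longleftrightarrow> finite (pverts X) \<and> parcs X \<subseteq> pverts X \<times> pverts X \<and> irrefl (parcs X) \<and> sym (parcs X)"
proof
  assume "pair_graph X"
  then interpret pair_graph X .
  show "finite (pverts X) \<and> parcs X \<subseteq> pverts X \<times> pverts X \<and> irrefl (parcs X) \<and> sym (parcs X)"
    using pair_finite_verts arc_fst_in_verts arc_snd_in_verts pair_no_loops pair_sym_arcs
    by (fastforce simp: irrefl_def symmetric_def)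
next
  assume *: "finite (pverts X) \<and> parcs X \<subseteq> pverts X \<times> pverts X \<and> irrefl (parcs X) \<and> sym (parcs X)"
  then have "finite (parcs X)"
    by (meson finite_SigmaI finite_subset)
  with * show "pair_graph X"
    by unfold_locales (auto simp: irrefl_def symmetric_def)
qed

lemma pair_graph_K1: "pair_graph K1"
  by (simp add: pair_graph_altdef K1_def irrefl_def sym_def)

lemma pair_graph_join: "pair_graph A \<Longrightarrow> pair_graph B \<Longrightarrow> pair_graph (graph_join A B)"
  unfolding pair_graph_altdef graph_join_def by (auto simp: irrefl_def sym_def)

lemma pair_graph_corona: "pair_graph G \<Longrightarrow> pair_graph H \<Longrightarrow> pair_graph (corona G H)"
  unfolding pair_graph_altdef corona_def by (auto simp: irrefl_def sym_def)

end

theory Submission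
  imports Defs
begin

text \<open>
  In a graph of diameter at most two, two non-adjacent vertices, or two adjacent vertices with the
  same further neighbours, are strongly resolved only by themselves. Call such a pair a conflict.
  A set that meets every conflict also resolves the remaining pairs: if \<open>u\<close>, \<open>v\<close> are adjacent and
  \<open>w\<close> is a neighbour of \<open>u\<close> only, then \<open>v\<close>, \<open>w\<close> is a conflict. Hence the strong metric dimension
  is the least size \<open>c\<close> of a set meeting every conflict. A new universal vertex is in conflict with
  exactly the old universal ones, so that \<open>c(K\<^sub>1 + H)\<close> is \<open>c(H) + 1\<close> if \<open>H\<close> has a universal vertex
  and \<open>c(H)\<close> otherwise.

  In a corona product, vertices of different copies of \<open>H\<close> are resolved only by themselves. So a
  strong resolving set contains all copies of \<open>H\<close> but one, and in that copy, where distances are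
  capped at two, it meets every conflict of \<open>H\<close>. Conversely, if there are at least two copies, such
  sets suffice, and the dimension is \<open>(n\<^sub>1 - 1) n\<^sub>2 + c(H)\<close> whether or not \<open>H\<close> is connected.
  For \<open>n\<^sub>1 = 1\<close> the corona product is \<open>K\<^sub>1 + H\<close>.
\<close>

section \<open>Distance functions\<close>

text \<open>These local conditions determine \<open>D\<close> as the graph distance and can be checked arc by arc.\<close>

definition dist_fun :: "'a pair_pre_digraph \<Rightarrow> ('a \<Rightarrow> 'a \<Rightarrow> nat) \<Rightarrow> bool" where
  "dist_fun X D \<longleftrightarrow> (\<forall>u\<in>pverts X. D u u = 0 \<and>
     (\<forall>(x, y)\<in>parcs X. D u y \<le> Suc (D u x)) \<and>
     (\<forall>v\<in>pverts X. v \<noteq> u \<longrightarrow> (\<exists>x. (x, v) \<in> parcs X \<and> D u v = Suc (D u x))))"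

lemma dist_fun_refl: "dist_fun X D \<Longrightarrow> u \<in> pverts X \<Longrightarrow> D u u = 0"
  and dist_fun_step:
    "dist_fun X D \<Longrightarrow> u \<in> pverts X \<Longrightarrow> (x, y) \<in> parcs X \<Longrightarrow> D u y \<le> Suc (D u x)"
  and dist_fun_pred:
    "dist_fun X D \<Longrightarrow> u \<in> pverts X \<Longrightarrow> v \<in> pverts X \<Longrightarrow> v \<noteq> u \<Longrightarrow>
       \<exists>x. (x, v) \<in> parcs X \<and> D u v = Suc (D u x)"
  unfolding dist_fun_def by blast+

lemma dist_funI:
  assumes "\<And>u. u \<in> pverts X \<Longrightarrow> D u u = 0"
    and "\<And>u x y. u \<in> pverts X \<Longrightarrow> (x, y) \<in> parcs X \<Longrightarrow> D u y \<le> Suc (D u x)"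
    and "\<And>u v. u \<in> pverts X \<Longrightarrow> v \<in> pverts X \<Longrightarrow> v \<noteq> u \<Longrightarrow>
           \<exists>x. (x, v) \<in> parcs X \<and> D u v = Suc (D u x)"
  shows "dist_fun X D"
  using assms unfolding dist_fun_def by blast

section \<open>Walks, geodesics and connectedness through distance functions\<close>

context pair_graph
begin

lemma dist_fun_le_length:
  assumes "dist_fun G D" "awalk u p v"
  shows "D u v \<le> length p"
  using assms(2)
proof (induction p arbitrary: v rule: rev_induct)
  case Nil
  then show ?case using dist_fun_refl[OF assms(1)] by (auto simp: awalk_Nil_iff)
next
  case (snoc e p)
  have u: "u \<in> pverts G" using snoc.prems by auto
  obtain x y where e: "e = (x, y)" by force
  have *: "awalk u p x" "(x, v) \<in> parcs G"
    using snoc.prems by (auto simp: e awalk_Cons_iff awalk_Nil_iff)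
  have "D u v \<le> Suc (D u x)"
    using dist_fun_step[OF assms(1) u *(2)] .
  then show ?case using snoc.IH[OF *(1)] by simp
qed

text \<open>Going back from \<open>v\<close> along predecessors lowers \<open>D u\<close> by one
  each time, and only \<open>u\<close> has value 0.\<close>

lemma dist_fun_walk:
  assumes "dist_fun G D" "u \<in> pverts G" "v \<in> pverts G"
  shows "\<exists>p. awalk u p v \<and> length p = D u v"
  using assms(3)
proof (induction "D u v" arbitrary: v)
  case 0
  then have "v = u" using dist_fun_pred[OF assms(1,2) 0(2)] by auto
  then show ?case using 0 assms(2) by (intro exI[of _ "[]"]) (auto simp: awalk_Nil_iff)
next
  case (Suc n)
  then have "v \<noteq> u" using dist_fun_refl[OF assms(1,2)] by auto
  then obtain x where x: "(x, v) \<in> parcs G" "D u v = Suc (D u x)"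
    using dist_fun_pred[OF assms(1,2) Suc.prems] by blast
  have "n = D u x" "x \<in> pverts G" using x Suc.hyps(2) in_arcsD1 by auto
  then obtain p where p: "awalk u p x" "length p = D u x"
    using Suc.hyps(1) by blast
  have "awalk x [(x, v)] v"
    using x(1) Suc.prems by (auto simp: awalk_simps)
  then have "awalk u (p @ [(x, v)]) v"
    using p(1) awalk_appendI by blast
  then show ?case using p(2) x(2) by (intro exI[of _ "p @ [(x, v)]"]) simp
qed

lemma dist_fun_triangle:
  assumes "dist_fun G D" "u \<in> pverts G" "v \<in> pverts G" "w \<in> pverts G"
  shows "D u w \<le> D u v + D v w"
proof -
  obtain p q where "awalk u p v" "length p = D u v" "awalk v q w" "length q = D v w"
    using dist_fun_walk[OF assms(1)] assms(2-) by metis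
  then show ?thesis
    using dist_fun_le_length[OF assms(1) awalk_appendI[of u p v q w]] by simp
qed

lemma awalk_cost_one: "awalk_cost (\<lambda>_. 1) p = real (length p)"
  by (induction p) auto

lemma graph_dist_eq_dist_fun:
  assumes "dist_fun G D" "u \<in> pverts G" "v \<in> pverts G"
  shows "graph_dist G u v = ereal (real (D u v))"
proof -
  have "\<mu> (\<lambda>_. 1) u v = ereal (real (D u v))"
  proof (rule antisym)
    show "\<mu> (\<lambda>_. 1) u v \<le> ereal (real (D u v))"
      using dist_fun_walk[OF assms] min_cost_le_walk_cost by (metis awalk_cost_one)
    show "ereal (real (D u v)) \<le> \<mu> (\<lambda>_. 1) u v"
      unfolding \<mu>_def
      by (rule INF_greatest) (use dist_fun_le_length[OF assms(1)] in \<open>simp add: awalk_cost_one\<close>)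
  qed
  then show ?thesis by (simp add: graph_dist_def)
qed

text \<open>Cutting a shortest path at \<open>v\<close> gives two walks, hence one inequality, and
  the triangle inequality is the other. Conversely, the equation makes the concatenation of two
  shortest walks a shortest one.\<close>

lemma geodesic_interval_iff:
  assumes D: "dist_fun G D" and V: "u \<in> pverts G" "v \<in> pverts G" "w \<in> pverts G"
  shows "v \<in> geodesic_interval G u w \<longleftrightarrow> D u w = D u v + D v w"
proof
  assume "v \<in> geodesic_interval G u w"
  then obtain p where p: "awalk u p w" "length p = D u w" "v \<in> set (awalk_verts u p)"
    using graph_dist_eq_dist_fun[OF D V(1,3)]
    by (auto simp: geodesic_interval_def shortest_path_def apath_def)
  then obtain q r where qr: "p = q @ r" "awalk u q v" "awalk v r w"
    using awalk_decomp by blast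
  have "D u v + D v w \<le> D u w"
    using dist_fun_le_length[OF D qr(2)] dist_fun_le_length[OF D qr(3)] p(2) qr(1) by simp
  moreover have "D u w \<le> D u v + D v w" using dist_fun_triangle[OF D V] .
  ultimately show "D u w = D u v + D v w" by simp
next
  assume eq: "D u w = D u v + D v w"
  obtain q r where q: "awalk u q v" "length q = D u v" and r: "awalk v r w" "length r = D v w"
    using dist_fun_walk[OF D] V by metis
  have walk: "awalk u (q @ r) w" using q r awalk_appendI by blast
  \<comment> \<open>\<open>shortest_path\<close> asks for a path: at a repeated vertex the closed
    part \<open>b\<close> could be cut out, leaving a walk shorter than
    \<open>D u w\<close>.\<close>
  have "distinct (awalk_verts u (q @ r))"
  proof (rule ccontr)
    assume "\<not> distinct (awalk_verts u (q @ r))"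
    then obtain a b c y where abc: "q @ r = a @ b @ c" "0 < length b" "awalk u a y" "awalk y c w"
      using awalk_not_distinct_decomp[OF walk] by blast
    then have "length (q @ r) = length a + length b + length c" by simp
    moreover have "D u w \<le> length (a @ c)"
      using dist_fun_le_length[OF D] awalk_appendI[OF abc(3,4)] by blast
    ultimately show False using eq q r abc(2) by simp
  qed
  then have "shortest_path G u (q @ r) w"
    using walk eq q r graph_dist_eq_dist_fun[OF D V(1,3)]
    by (simp add: shortest_path_def apath_def)
  moreover have "v \<in> set (awalk_verts u (q @ r))"
    using set_awalk_verts_append[OF q(1) r(1)] hd_in_awalk_verts(1)[OF r(1)] by blast
  ultimately show "v \<in> geodesic_interval G u w"
    by (auto simp: geodesic_interval_def)
qed

lemma strongly_resolves_iff:
  assumes "dist_fun G D" "u \<in> pverts G" "v \<in> pverts G" "w \<in> pverts G"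
  shows "strongly_resolves G w u v \<longleftrightarrow> D u w = D u v + D v w \<or> D v w = D v u + D u w"
  unfolding strongly_resolves_def
  using geodesic_interval_iff[OF assms(1,2,3,4)] geodesic_interval_iff[OF assms(1,3,2,4)] by blast

text \<open>\<open>connected\<close> refers to the symmetric closure, which has the same
  reachability because the arcs are already symmetric.\<close>

lemma connected_iff:
  "connected (with_proj G) \<longleftrightarrow>
     pverts G \<noteq> {} \<and> (\<forall>u\<in>pverts G. \<forall>v\<in>pverts G. \<exists>p. awalk u p v)"
proof -
  have "pverts (mk_symmetric (with_proj G)) = pverts G" by (simp add: mk_symmetric_def)
  then show ?thesis
    unfolding connected_def strongly_connected_def reachable_mk_symmetric_eq[OF sym_arcs]
      reachable_awalk with_proj_simps by simp
qed

lemma dist_fun_imp_connected: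
  assumes "dist_fun G D" "pverts G \<noteq> {}"
  shows "connected (with_proj G)"
  unfolding connected_iff using assms(2) dist_fun_walk[OF assms(1)] by blast

lemma connected_imp_dist_fun:
  assumes "connected (with_proj G)"
  shows "\<exists>D. dist_fun G D"
proof
  define D where "D u v = (LEAST n. \<exists>p. awalk u p v \<and> length p = n)" for u v
  have D_le: "D u v \<le> length p" if "awalk u p v" for u v p
    unfolding D_def by (rule Least_le) (use that in blast)
  have D_ex: "\<exists>p. awalk u p v \<and> length p = D u v" if "u \<in> pverts G" "v \<in> pverts G" for u v
  proof -
    obtain p where "awalk u p v" using assms \<open>u \<in> _\<close> \<open>v \<in> _\<close> unfolding connected_iff by blast
    then have "\<exists>n p. awalk u p v \<and> length p = n" by blast
    then show ?thesis unfolding D_def by (rule LeastI_ex)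
  qed
  have step: "D u y \<le> Suc (D u x)" if "u \<in> pverts G" "(x, y) \<in> parcs G" for u x y
  proof -
    have "x \<in> pverts G" "y \<in> pverts G" using \<open>(x, y) \<in> _\<close> in_arcsD1 in_arcsD2 by blast+
    then obtain p where p: "awalk u p x" "length p = D u x"
      using D_ex \<open>u \<in> _\<close> by blast
    have "awalk x [(x, y)] y"
      using \<open>(x, y) \<in> _\<close> \<open>y \<in> _\<close> by (simp add: awalk_simps)
    then have "D u y \<le> length (p @ [(x, y)])"
      using p(1) awalk_appendI D_le by blast
    then show ?thesis using p(2) by simp
  qed
  have "D u u = 0" if "u \<in> pverts G" for u
    using D_le[of u "[]" u] that by (simp add: awalk_Nil_iff)
  \<comment> \<open>The predecessor is the tail of the last arc of a shortest walk: dropping that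
    arc gives one inequality, \<open>step\<close> the other.\<close>
  moreover have "\<exists>x. (x, v) \<in> parcs G \<and> D u v = Suc (D u x)"
    if uv: "u \<in> pverts G" "v \<in> pverts G" "v \<noteq> u" for u v
  proof -
    obtain p where p: "awalk u p v" "length p = D u v" using D_ex uv by blast
    then obtain q x y where q: "p = q @ [(x, y)]"
      using uv(3) by (cases p rule: rev_cases) (auto simp: awalk_Nil_iff)
    then have *: "awalk u q x" "(x, v) \<in> parcs G"
      using p(1) by (auto simp: awalk_simps)
    then have "D u v = Suc (D u x)"
      using D_le[OF *(1)] step[OF uv(1) *(2)] p(2) q by simp
    then show ?thesis using *(2) by blast
  qed
  ultimately show "dist_fun G D"
    using step by (intro dist_funI)
qed

end


section \<open>Conflict covers\<close>

text \<open>For adjacent vertices the last disjunct makes them true twins (equal closed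
  neighbourhoods). In a \<open>pair_graph\<close>, conflicts are the mutually maximally distant
  pairs for distances capped at two, and a \<open>conflict_cover\<close> is a vertex cover of the
  graph of these pairs.\<close>

definition conflict :: "'a pair_pre_digraph \<Rightarrow> 'a \<Rightarrow> 'a \<Rightarrow> bool" where
  "conflict X u v \<longleftrightarrow> u \<in> pverts X \<and> v \<in> pverts X \<and> u \<noteq> v \<and>
     ((u, v) \<notin> parcs X \<or>
      (\<forall>w. w \<noteq> u \<longrightarrow> w \<noteq> v \<longrightarrow> ((u, w) \<in> parcs X \<longleftrightarrow> (v, w) \<in> parcs X)))"

definition conflict_cover :: "'a pair_pre_digraph \<Rightarrow> 'a set \<Rightarrow> bool" where
  "conflict_cover X S \<longleftrightarrow> S \<subseteq> pverts X \<and> (\<forall>u v. conflict X u v \<longrightarrow> u \<in> S \<or> v \<in> S)"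

definition cover_number :: "'a pair_pre_digraph \<Rightarrow> nat" where
  "cover_number X = (LEAST k. \<exists>S. conflict_cover X S \<and> card S = k)"

lemma cover_number_le: "conflict_cover X S \<Longrightarrow> cover_number X \<le> card S"
  unfolding cover_number_def by (rule Least_le) blast

lemma cover_number_attained: "\<exists>S. conflict_cover X S \<and> card S = cover_number X"
proof -
  have "conflict_cover X (pverts X)" by (auto simp: conflict_cover_def conflict_def)
  then have "\<exists>k S. conflict_cover X S \<and> card S = k" by blast
  then show ?thesis unfolding cover_number_def by (rule LeastI_ex)
qed

text \<open>The distance truncated at two, also between components. Vertices of \<open>H\<close>
  have this distance inside \<open>K1 + H\<close> and inside a copy in a corona product, where the
  apex offers a detour of length two.\<close>

definition capped_dist :: "'a pair_pre_digraph \<Rightarrow> 'a \<Rightarrow> 'a \<Rightarrow> nat" where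
  "capped_dist X u v = (if u = v then 0 else if (u, v) \<in> parcs X then 1 else 2)"

lemma pair_graph_arc_sym: "pair_graph X \<Longrightarrow> (u, v) \<in> parcs X \<longleftrightarrow> (v, u) \<in> parcs X"
  by (auto simp: pair_graph_altdef dest: symD)

lemma pair_graph_no_loop: "pair_graph X \<Longrightarrow> (u, u) \<notin> parcs X"
  by (auto simp: pair_graph_altdef irrefl_def)

text \<open>The use of \<open>capped_dist\<close> instead of \<open>strongly_resolves\<close> makes
  this applicable to a copy of \<open>H\<close> in a corona product even if \<open>H\<close> is
  disconnected or of large diameter.\<close>

lemma conflict_cover_iff_capped_dist:
  assumes X: "pair_graph X" and S: "S \<subseteq> pverts X"
  shows "conflict_cover X S \<longleftrightarrow>
    (\<forall>u\<in>pverts X. \<forall>v\<in>pverts X. u \<noteq> v \<longrightarrow>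
       (\<exists>w\<in>S. capped_dist X u w = capped_dist X u v + capped_dist X v w \<or>
               capped_dist X v w = capped_dist X v u + capped_dist X u w))"
    (is "_ \<longleftrightarrow> (\<forall>u\<in>_. \<forall>v\<in>_. u \<noteq> v \<longrightarrow> ?resolved u v)")
proof
  note sym = pair_graph_arc_sym[OF X]
  assume cover: "conflict_cover X S"
  have self: "?resolved u v" if "u \<in> S \<or> v \<in> S" for u v
  proof -
    have "capped_dist X u u = 0" "capped_dist X v v = 0" by (simp_all add: capped_dist_def)
    then show ?thesis using that by force
  qed
  have conflict: "?resolved u v" if "conflict X u v" for u v
    using cover that self unfolding conflict_cover_def by blast
  \<comment> \<open>\<open>v\<close> and \<open>w\<close> form a conflict, so one of them is in
    \<open>S\<close>: \<open>v\<close> resolves as an end of the pair, \<open>w\<close> because 2 =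
    1 + 1. Both orders are recorded since either end may own the private neighbour.\<close>
  have asymmetric: "?resolved u v \<and> ?resolved v u"
    if uv: "v \<in> pverts X" "(u, v) \<in> parcs X" and w: "w \<noteq> v" "(u, w) \<in> parcs X" "(v, w) \<notin> parcs X"
    for u v w
  proof -
    have "w \<in> pverts X" using w(2) X by (auto simp: pair_graph_altdef)
    then have "conflict X v w" using uv w by (auto simp: conflict_def)
    then have "v \<in> S \<or> w \<in> S" using cover by (auto simp: conflict_cover_def)
    moreover have "u \<noteq> v" "u \<noteq> w" using uv(2) w(2) pair_graph_no_loop[OF X] by auto
    ultimately have "capped_dist X u w = 1" "capped_dist X v w = 2" "capped_dist X v u = 1"
      and S: "v \<in> S \<or> w \<in> S"
      using uv w sym[of u v] by (auto simp: capped_dist_def)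
    then have "capped_dist X v w = capped_dist X v u + capped_dist X u w" by simp
    then show ?thesis using S self[of u v] self[of v u] by blast
  qed
  show "\<forall>u\<in>pverts X. \<forall>v\<in>pverts X. u \<noteq> v \<longrightarrow> ?resolved u v"
  proof (intro ballI impI)
    fix u v assume uv: "u \<in> pverts X" "v \<in> pverts X" "u \<noteq> v"
    show "?resolved u v"
    proof (cases "conflict X u v")
      case False
      then obtain w where w: "(u, v) \<in> parcs X" "w \<noteq> u" "w \<noteq> v"
          "(u, w) \<in> parcs X \<and> (v, w) \<notin> parcs X \<or> (v, w) \<in> parcs X \<and> (u, w) \<notin> parcs X"
        using uv by (auto simp: conflict_def)
      then have "(v, u) \<in> parcs X" using sym by blast
      then show ?thesis
        using asymmetric[of v u w] asymmetric[of u v w] uv w by blast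
    qed (rule conflict)
  qed
next
  note sym = pair_graph_arc_sym[OF X]
  assume resolved: "\<forall>u\<in>pverts X. \<forall>v\<in>pverts X. u \<noteq> v \<longrightarrow> ?resolved u v"
  show "conflict_cover X S"
    unfolding conflict_cover_def
  proof (intro conjI allI impI S)
    fix u v assume c: "conflict X u v"
    then obtain w where w: "w \<in> S" and
      eq: "capped_dist X u w = capped_dist X u v + capped_dist X v w \<or>
           capped_dist X v w = capped_dist X v u + capped_dist X u w"
      using resolved unfolding conflict_def by meson
    \<comment> \<open>For a third vertex the equation fails: if \<open>u\<close>, \<open>v\<close>
      are not adjacent, the right side is at least 2 + 1; if they are twins, their distances to
      \<open>w\<close> agree.\<close>
    have "w = u \<or> w = v"
    proof (rule ccontr)
      assume "\<not> (w = u \<or> w = v)"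
      then show False
        using c eq sym[of u v] by (auto simp: conflict_def capped_dist_def split: if_splits)
    qed
    then show "u \<in> S \<or> v \<in> S" using w by blast
  qed
qed

section \<open>Graphs of diameter at most two\<close>

definition diameter_le_two :: "'a pair_pre_digraph \<Rightarrow> bool" where
  "diameter_le_two X \<longleftrightarrow> (\<forall>u\<in>pverts X. \<forall>v\<in>pverts X. u \<noteq> v \<longrightarrow> (u, v) \<notin> parcs X \<longrightarrow>
     (\<exists>x. (u, x) \<in> parcs X \<and> (x, v) \<in> parcs X))"

text \<open>A common neighbour is the predecessor at distance two, so truncation changes
  nothing.\<close>

lemma dist_fun_capped_dist:
  assumes "pair_graph X" "diameter_le_two X"
  shows "dist_fun X (capped_dist X)"
proof (rule dist_funI)
  fix u v assume uv: "u \<in> pverts X" "v \<in> pverts X" "v \<noteq> u"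
  show "\<exists>x. (x, v) \<in> parcs X \<and> capped_dist X u v = Suc (capped_dist X u x)"
  proof (cases "(u, v) \<in> parcs X")
    case True
    then show ?thesis using uv by (intro exI[of _ u]) (auto simp: capped_dist_def)
  next
    case False
    then obtain x where "(u, x) \<in> parcs X" "(x, v) \<in> parcs X"
      using assms(2) uv unfolding diameter_le_two_def by metis
    then show ?thesis
      using uv False pair_graph_no_loop[OF assms(1)]
      by (intro exI[of _ x]) (auto simp: capped_dist_def)
  qed
qed (auto simp: capped_dist_def)

lemma strong_metric_dim_eq_cover_number:
  assumes X: "pair_graph X" and "diameter_le_two X"
  shows "strong_metric_dim X = cover_number X"
proof -
  have "strong_resolving_set X S \<longleftrightarrow> conflict_cover X S" for S
  proof (cases "S \<subseteq> pverts X")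
    case True
    then have "strongly_resolves X w u v \<longleftrightarrow>
        capped_dist X u w = capped_dist X u v + capped_dist X v w \<or>
        capped_dist X v w = capped_dist X v u + capped_dist X u w"
      if "u \<in> pverts X" "v \<in> pverts X" "w \<in> S" for u v w
      using pair_graph.strongly_resolves_iff[OF X dist_fun_capped_dist[OF assms]] that by blast
    then show ?thesis
      using True by (simp add: conflict_cover_iff_capped_dist[OF X True] strong_resolving_set_def)
  qed (simp add: strong_resolving_set_def conflict_cover_def)
  then show ?thesis by (simp add: strong_metric_dim_def cover_number_def)
qed

section \<open>Adding a universal vertex\<close>

definition universal :: "'a pair_pre_digraph \<Rightarrow> 'a \<Rightarrow> bool" where
  "universal X a \<longleftrightarrow> a \<in> pverts X \<and> (\<forall>v\<in>pverts X. v \<noteq> a \<longrightarrow> (a, v) \<in> parcs X)"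

lemma universal_imp_diameter_le_two:
  assumes "pair_graph X" "universal X a"
  shows "diameter_le_two X"
  unfolding diameter_le_two_def
proof (intro ballI impI)
  fix u v assume uv: "u \<in> pverts X" "v \<in> pverts X" "u \<noteq> v" "(u, v) \<notin> parcs X"
  then have "u \<noteq> a" "v \<noteq> a"
    using assms(2) pair_graph_arc_sym[OF assms(1), of u v] by (auto simp: universal_def)
  then show "\<exists>x. (u, x) \<in> parcs X \<and> (x, v) \<in> parcs X"
    using uv assms(2) pair_graph_arc_sym[OF assms(1), of u a] by (auto simp: universal_def)
qed

text \<open>\<open>X\<close> is \<open>K1 + H\<close> up to renaming, with apex \<open>x\<close>.
  The locale serves both the join and the corona product over a single vertex.\<close>

locale universal_extension =
  fixes H :: "'b pair_pre_digraph" and X :: "'c pair_pre_digraph"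
    and f :: "'b \<Rightarrow> 'c" and x :: 'c
  assumes H: "pair_graph H" and X: "pair_graph X"
    and inj: "inj f" and x: "x \<notin> range f"
    and verts: "pverts X = insert x (f ` pverts H)"
    and arcs: "(f h, f h') \<in> parcs X \<longleftrightarrow> (h, h') \<in> parcs H"
    and apex: "h \<in> pverts H \<Longrightarrow> (x, f h) \<in> parcs X"
begin

lemma universal_apex: "universal X x"
  using verts apex by (auto simp: universal_def)

lemma arcs_apex: "(x, f h) \<in> parcs X \<longleftrightarrow> h \<in> pverts H" "(f h, x) \<in> parcs X \<longleftrightarrow> h \<in> pverts H"
proof -
  show *: "(x, f h) \<in> parcs X \<longleftrightarrow> h \<in> pverts H"
  proof
    assume "(x, f h) \<in> parcs X"
    then have "f h \<in> pverts X" using X by (auto simp: pair_graph_altdef)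
    then show "h \<in> pverts H" using verts x inj by (auto dest: injD)
  qed (rule apex)
  show "(f h, x) \<in> parcs X \<longleftrightarrow> h \<in> pverts H"
    using * pair_graph_arc_sym[OF X] by blast
qed

lemma arc_cases:
  assumes "(u, v) \<in> parcs X"
  shows "v = x \<or> v \<in> f ` pverts H"
  using assms verts X by (auto simp: pair_graph_altdef)

text \<open>The only new vertex that could tell two image vertices apart is the apex, and it is
  adjacent to both.\<close>

lemma conflict_image: "conflict X (f h) (f h') \<longleftrightarrow> conflict H h h'"
proof -
  have V: "f k \<in> pverts X \<longleftrightarrow> k \<in> pverts H" for k
    using verts x inj by (auto dest: injD)
  have twins: "(\<forall>w. w \<noteq> f h \<longrightarrow> w \<noteq> f h' \<longrightarrow> ((f h, w) \<in> parcs X \<longleftrightarrow> (f h', w) \<in> parcs X)) \<longleftrightarrow>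
      (\<forall>w. w \<noteq> h \<longrightarrow> w \<noteq> h' \<longrightarrow> ((h, w) \<in> parcs H \<longleftrightarrow> (h', w) \<in> parcs H))" (is "?L \<longleftrightarrow> ?R")
    if "h \<in> pverts H" "h' \<in> pverts H"
  proof
    assume ?L
    then show ?R using arcs inj by (metis injD)
  next
    assume R: ?R
    show ?L
    proof (intro allI impI)
      fix w assume w: "w \<noteq> f h" "w \<noteq> f h'"
      consider "w = x" | k where "w = f k" | "w \<notin> pverts X" using verts by blast
      then show "(f h, w) \<in> parcs X \<longleftrightarrow> (f h', w) \<in> parcs X"
      proof cases
        case 1
        then show ?thesis using that arcs_apex by blast
      next
        case 2
        then have "k \<noteq> h" "k \<noteq> h'" using w by auto
        then show ?thesis using R unfolding 2 arcs by blast
      next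
        case 3
        then show ?thesis using X by (auto simp: pair_graph_altdef)
      qed
    qed
  qed
  show ?thesis
    using twins V arcs inj by (auto simp: conflict_def dest: injD)
qed

text \<open>The apex is adjacent to every other vertex, so a conflict with it can only be a twin
  pair.\<close>

lemma conflict_apex:
  assumes "h \<in> pverts H"
  shows "conflict X x (f h) \<longleftrightarrow> universal H h"
proof
  assume c: "conflict X x (f h)"
  have "(h, v) \<in> parcs H" if "v \<in> pverts H" "v \<noteq> h" for v
  proof -
    have "f v \<noteq> x" "f v \<noteq> f h" using that x inj by (auto dest: injD)
    then have "(f h, f v) \<in> parcs X"
      using c apex[OF assms] apex[OF that(1)] by (auto simp: conflict_def)
    then show ?thesis using arcs by blast
  qed
  then show "universal H h" using assms by (auto simp: universal_def)
next
  assume u: "universal H h"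
  have "(x, w) \<in> parcs X \<longleftrightarrow> (f h, w) \<in> parcs X" if "w \<noteq> x" "w \<noteq> f h" for w
  proof (cases "w \<in> f ` pverts H")
    case True
    then show ?thesis using that u arcs apex by (auto simp: universal_def)
  next
    case False
    then show ?thesis using arc_cases that by blast
  qed
  then show "conflict X x (f h)"
    using assms x verts by (auto simp: conflict_def)
qed

lemma conflict_cover_iff:
  assumes "S \<subseteq> pverts X"
  shows "conflict_cover X S \<longleftrightarrow> conflict_cover H (f -` S) \<and>
    (x \<in> S \<or> (\<forall>h. universal H h \<longrightarrow> f h \<in> S))"
proof -
  have "f -` S \<subseteq> pverts H" using assms verts x inj by (auto dest: injD)
  moreover have "(\<forall>u v. conflict X u v \<longrightarrow> u \<in> S \<or> v \<in> S) \<longleftrightarrow>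
      (\<forall>h h'. conflict H h h' \<longrightarrow> f h \<in> S \<or> f h' \<in> S) \<and>
      (\<forall>h. universal H h \<longrightarrow> x \<in> S \<or> f h \<in> S)" (is "?L \<longleftrightarrow> ?R")
  proof
    assume L: ?L
    then have "\<forall>h h'. conflict H h h' \<longrightarrow> f h \<in> S \<or> f h' \<in> S"
      using conflict_image by blast
    moreover have "x \<in> S \<or> f h \<in> S" if "universal H h" for h
      using L conflict_apex that unfolding universal_def by blast
    ultimately show ?R by blast
  next
    assume R: ?R
    have sym: "conflict X v u" if "conflict X u v" for u v
      using that pair_graph_arc_sym[OF X, of u v] unfolding conflict_def by blast
    show ?L
    proof (intro allI impI)
      fix u v assume c: "conflict X u v"
      then have in_verts: "u \<in> insert x (f ` pverts H)" "v \<in> insert x (f ` pverts H)" "u \<noteq> v"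
        unfolding verts[symmetric] conflict_def by blast+
      consider h h' where "u = f h" "v = f h'"
        | h where "u = x" "v = f h" "h \<in> pverts H" | h where "u = f h" "v = x" "h \<in> pverts H"
        using in_verts by blast
      then show "u \<in> S \<or> v \<in> S"
      proof cases
        case 1
        then show ?thesis using c conflict_image R by blast
      next
        case 2
        then show ?thesis using c conflict_apex R by blast
      next
        case 3
        then show ?thesis using sym[OF c] conflict_apex R by blast
      qed
    qed
  qed
  ultimately show ?thesis
    using assms by (auto simp: conflict_cover_def)
qed

lemma card_split:
  assumes "S \<subseteq> pverts X"
  shows "card S = card (f -` S) + (if x \<in> S then 1 else 0)"
proof -
  have fin: "finite S"
    by (rule finite_subset[OF assms]) (use X in \<open>simp add: pair_graph_altdef\<close>)
  have S: "S - {x} = f ` (f -` S)" using assms verts x by auto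
  have "card (S - {x}) = card (f -` S)"
    unfolding S by (rule card_image) (use inj in \<open>auto intro: inj_on_subset\<close>)
  then show ?thesis using fin by (auto simp: card.remove)
qed

text \<open>The apex is in no conflict, so covers of \<open>H\<close> push forward by image and
  covers of \<open>X\<close> pull back by preimage without growing.\<close>

lemma cover_number_no_universal:
  assumes "\<And>a. \<not> universal H a"
  shows "cover_number X = cover_number H"
proof (rule antisym)
  obtain T where T: "conflict_cover H T" "card T = cover_number H"
    using cover_number_attained by blast
  have sub: "f ` T \<subseteq> pverts X" using T(1) verts by (auto simp: conflict_cover_def)
  have pre: "f -` f ` T = T" using inj by (simp add: inj_vimage_image_eq)
  have "x \<notin> f ` T" using x by blast
  then show "cover_number X \<le> cover_number H"
    using cover_number_le[of X "f ` T"] conflict_cover_iff[OF sub] card_split[OF sub] T assms pre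
    by auto
next
  obtain S where S: "conflict_cover X S" "card S = cover_number X"
    using cover_number_attained by blast
  then have sub: "S \<subseteq> pverts X" by (simp add: conflict_cover_def)
  then show "cover_number H \<le> cover_number X"
    using S conflict_cover_iff[OF sub] card_split[OF sub] cover_number_le[of H "f -` S"] by auto
qed

text \<open>Adding the apex to a cover of \<open>H\<close> covers \<open>X\<close>. Conversely, a
  cover of \<open>X\<close> can lose one vertex on its way to \<open>H\<close>: the apex if it is
  present, otherwise \<open>a\<close>.\<close>

lemma cover_number_universal:
  assumes a: "universal H a"
  shows "cover_number X = cover_number H + 1"
proof (rule antisym)
  obtain T where T: "conflict_cover H T" "card T = cover_number H"
    using cover_number_attained by blast
  have sub: "insert x (f ` T) \<subseteq> pverts X" using T(1) verts by (auto simp: conflict_cover_def)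
  have "f -` {x} = {}" using x by auto
  then have pre: "f -` insert x (f ` T) = T"
    using inj by (subst vimage_insert) (simp add: inj_vimage_image_eq)
  have "conflict_cover X (insert x (f ` T))"
    unfolding conflict_cover_iff[OF sub] pre using T(1) by blast
  then have "cover_number X \<le> card (insert x (f ` T))" by (rule cover_number_le)
  also have "\<dots> = card T + 1" unfolding card_split[OF sub] pre by simp
  finally show "cover_number X \<le> cover_number H + 1" unfolding T(2) .
next
  obtain S where S: "conflict_cover X S" "card S = cover_number X"
    using cover_number_attained by blast
  then have sub: "S \<subseteq> pverts X" by (simp add: conflict_cover_def)
  have cover: "conflict_cover H (f -` S)" using S conflict_cover_iff[OF sub] by blast
  show "cover_number H + 1 \<le> cover_number X"
  proof (cases "x \<in> S")
    case True
    then show ?thesis using S card_split[OF sub] cover_number_le[OF cover] by simp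
  next
    case False
    then have univ: "f h \<in> S" if "universal H h" for h
      using S conflict_cover_iff[OF sub] that by blast
    \<comment> \<open>A conflict partner of a universal vertex is adjacent to it, hence its twin,
      hence universal.\<close>
    have twin: "universal H v" if c: "conflict H a v \<or> conflict H v a" for v
    proof -
      have v: "v \<in> pverts H" "v \<noteq> a" using c by (auto simp: conflict_def)
      then have av: "(a, v) \<in> parcs H" using a by (simp add: universal_def)
      then have va: "(v, a) \<in> parcs H" using pair_graph_arc_sym[OF H] by blast
      have "(v, w) \<in> parcs H" if "w \<in> pverts H" "w \<noteq> v" for w
      proof (cases "w = a")
        case False
        then have "(a, w) \<in> parcs H" using a that by (simp add: universal_def)
        then show ?thesis using c av va that False unfolding conflict_def by blast
      qed (simp add: va)
      then show ?thesis using v by (simp add: universal_def)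
    qed
    \<comment> \<open>\<open>a\<close> can be removed: its conflict partners are universal, and as
      \<open>S\<close> omits the apex it contains the images of all universal vertices.\<close>
    have "conflict_cover H (f -` S - {a})"
      unfolding conflict_cover_def
    proof (intro conjI allI impI)
      show "f -` S - {a} \<subseteq> pverts H" using cover by (auto simp: conflict_cover_def)
      fix u v assume uv: "conflict H u v"
      then have "u \<noteq> v" "u \<in> f -` S \<or> v \<in> f -` S"
        using cover by (simp_all add: conflict_def conflict_cover_def)
      moreover have "v \<in> f -` S" if "u = a" using twin[of v] univ[of v] uv that by simp
      moreover have "u \<in> f -` S" if "v = a" using twin[of u] univ[of u] uv that by simp
      ultimately show "u \<in> f -` S - {a} \<or> v \<in> f -` S - {a}" by blast
    qed
    moreover have "a \<in> f -` S" using univ a by simp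
    moreover have "finite (f -` S)"
      by (rule finite_subset[of _ "pverts H"])
        (use cover H in \<open>simp_all add: conflict_cover_def pair_graph_altdef\<close>)
    ultimately have "cover_number H + 1 \<le> card (f -` S)"
      using cover_number_le[of H "f -` S - {a}"] card.remove[of "f -` S" a] by linarith
    then show ?thesis using S card_split[OF sub] by simp
  qed
qed

end

lemma universal_extension_join:
  assumes "pair_graph H"
  shows "universal_extension H (graph_join K1 H) Inr (Inl ())"
proof (rule universal_extension.intro)
  show "pair_graph (graph_join K1 H)" using assms by (intro pair_graph_join pair_graph_K1)
qed (auto simp: assms graph_join_def K1_def)

lemma strong_metric_dim_join:
  assumes "pair_graph H"
  shows "strong_metric_dim (graph_join K1 H) = cover_number (graph_join K1 H)"
proof -
  interpret universal_extension H "graph_join K1 H" Inr "Inl ()"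
    using assms by (rule universal_extension_join)
  show ?thesis
    using strong_metric_dim_eq_cover_number[OF X universal_imp_diameter_le_two[OF X universal_apex]] .
qed

section \<open>Strong resolving sets of corona products\<close>

text \<open>Leaving or entering a copy costs one step at its attaching vertex; inside a copy the
  detour through that vertex caps the distance at two.\<close>

fun corona_dist :: "('a \<Rightarrow> 'a \<Rightarrow> nat) \<Rightarrow> 'b pair_pre_digraph \<Rightarrow> 'a + 'a \<times> 'b \<Rightarrow> 'a + 'a \<times> 'b \<Rightarrow> nat"
where
  "corona_dist D H (Inl a) (Inl b) = D a b"
| "corona_dist D H (Inl a) (Inr (b, h)) = D a b + 1"
| "corona_dist D H (Inr (a, h)) (Inl b) = D a b + 1"
| "corona_dist D H (Inr (a, h)) (Inr (b, h')) = (if a = b then capped_dist H h h' else D a b + 2)"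

lemma corona_verts [simp]:
  "Inl a \<in> pverts (corona G H) \<longleftrightarrow> a \<in> pverts G"
  "Inr (a, h) \<in> pverts (corona G H) \<longleftrightarrow> a \<in> pverts G \<and> h \<in> pverts H"
  by (auto simp: corona_def)

lemma corona_arcs [simp]:
  "(Inl a, Inl b) \<in> parcs (corona G H) \<longleftrightarrow> (a, b) \<in> parcs G"
  "(Inl a, Inr (b, h)) \<in> parcs (corona G H) \<longleftrightarrow> a = b \<and> a \<in> pverts G \<and> h \<in> pverts H"
  "(Inr (b, h), Inl a) \<in> parcs (corona G H) \<longleftrightarrow> a = b \<and> a \<in> pverts G \<and> h \<in> pverts H"
  "(Inr (a, h), Inr (b, h')) \<in> parcs (corona G H) \<longleftrightarrow> a = b \<and> a \<in> pverts G \<and> (h, h') \<in> parcs H"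
  by (auto simp: corona_def)

lemma corona_vert_cases:
  assumes "u \<in> pverts (corona G H)"
  obtains a where "u = Inl a" "a \<in> pverts G"
    | a h where "u = Inr (a, h)" "a \<in> pverts G" "h \<in> pverts H"
  using assms by (auto simp: corona_def)

lemma corona_arc_cases:
  assumes "(u, v) \<in> parcs (corona G H)"
  obtains a b where "u = Inl a" "v = Inl b" "(a, b) \<in> parcs G"
    | a h where "u = Inl a" "v = Inr (a, h)" "a \<in> pverts G" "h \<in> pverts H"
    | a h where "u = Inr (a, h)" "v = Inl a" "a \<in> pverts G" "h \<in> pverts H"
    | a h h' where "u = Inr (a, h)" "v = Inr (a, h')" "a \<in> pverts G" "(h, h') \<in> parcs H"
  using assms unfolding corona_def by auto

lemma dist_fun_corona:
  assumes D: "dist_fun G D" and H: "pair_graph H"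
  shows "dist_fun (corona G H) (corona_dist D H)"
proof (rule dist_funI)
  fix u assume "u \<in> pverts (corona G H)"
  then show "corona_dist D H u u = 0"
    by (rule corona_vert_cases) (simp_all add: dist_fun_refl[OF D] capped_dist_def)
next
  fix u x y assume u: "u \<in> pverts (corona G H)" and xy: "(x, y) \<in> parcs (corona G H)"
  show "corona_dist D H u y \<le> Suc (corona_dist D H u x)"
    using u
  proof (cases rule: corona_vert_cases)
    case (1 g)
    show ?thesis
      using xy by (cases rule: corona_arc_cases) (simp_all add: 1 dist_fun_step[OF D])
  next
    case (2 g k)
    show ?thesis
      using xy by (cases rule: corona_arc_cases)
        (auto simp: 2 dist_fun_step[OF D] dist_fun_refl[OF D] capped_dist_def)
  qed
next
  fix u v assume u: "u \<in> pverts (corona G H)" and v: "v \<in> pverts (corona G H)" and uv: "v \<noteq> u"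
  show "\<exists>x. (x, v) \<in> parcs (corona G H) \<and> corona_dist D H u v = Suc (corona_dist D H u x)"
    using v
  proof (cases rule: corona_vert_cases)
    case v: (1 b)
    show ?thesis
      using u
    proof (cases rule: corona_vert_cases)
      case (1 a)
      then have "b \<noteq> a" using uv v by simp
      from dist_fun_pred[OF D 1(2) v(2) this] obtain x
        where "(x, b) \<in> parcs G" "D a b = Suc (D a x)" by blast
      then show ?thesis using 1 v by (intro exI[of _ "Inl x"]) simp
    next
      case (2 a h)
      show ?thesis
      proof (cases "b = a")
        case True
        then show ?thesis
          using 2 v by (intro exI[of _ u]) (simp add: dist_fun_refl[OF D] capped_dist_def)
      next
        case False
        from dist_fun_pred[OF D 2(2) v(2) this] obtain x
          where "(x, b) \<in> parcs G" "D a b = Suc (D a x)" by blast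
        then show ?thesis using 2 v by (intro exI[of _ "Inl x"]) simp
      qed
    qed
  next
    case v: (2 b k)
    show ?thesis
      using u
    proof (cases rule: corona_vert_cases)
      case (1 a)
      then show ?thesis using v by (intro exI[of _ "Inl b"]) simp
    next
      case (2 a h)
      show ?thesis
      proof (cases "a = b \<and> (h, k) \<in> parcs H")
        case True
        then have "h \<noteq> k" using pair_graph_no_loop[OF H] by auto
        then show ?thesis using True 2 v by (intro exI[of _ u]) (simp add: capped_dist_def)
      next
        case False
        \<comment> \<open>The last step comes from the attaching vertex \<open>Inl b\<close>. For
          \<open>a = b\<close> the distance is 2, as \<open>h\<close> and \<open>k\<close> are
          distinct and not adjacent.\<close>
        then show ?thesis
          using 2 v uv by (intro exI[of _ "Inl b"]) (auto simp: dist_fun_refl[OF D] capped_dist_def)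
      qed
    qed
  qed
qed

text \<open>The candidates for minimum strong resolving sets. They avoid the vertices of
  \<open>G\<close>, whose role is taken over by the pendant vertices behind them.\<close>

definition corona_resolver ::
  "'a pair_pre_digraph \<Rightarrow> 'b pair_pre_digraph \<Rightarrow> 'a \<Rightarrow> 'b set \<Rightarrow> ('a + 'a \<times> 'b) set" where
  "corona_resolver G H g T = Inr ` ((pverts G - {g}) \<times> pverts H \<union> {g} \<times> T)"

lemma card_corona_resolver:
  assumes "pair_graph G" "pair_graph H" "g \<in> pverts G" "T \<subseteq> pverts H"
  shows "card (corona_resolver G H g T) = (card (pverts G) - 1) * card (pverts H) + card T"
proof -
  have "finite (pverts G)" "finite (pverts H)" using assms by (simp_all add: pair_graph_altdef)
  moreover from this have "finite T" using assms(4) finite_subset by blast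
  ultimately have "card ((pverts G - {g}) \<times> pverts H \<union> {g} \<times> T) =
      (card (pverts G) - 1) * card (pverts H) + card T"
    using assms(3) by (subst card_Un_disjoint) (auto simp: card_cartesian_product)
  then show ?thesis unfolding corona_resolver_def by (simp add: card_image)
qed

section \<open>Lower and upper bound for corona products\<close>

context
  fixes G :: "'a pair_pre_digraph" and H :: "'b pair_pre_digraph"
    and D :: "'a \<Rightarrow> 'a \<Rightarrow> nat"
  assumes G: "pair_graph G" and H: "pair_graph H" and D: "dist_fun G D"
begin

lemma strongly_resolves_corona_iff:
  assumes "u \<in> pverts (corona G H)" "v \<in> pverts (corona G H)" "w \<in> pverts (corona G H)"
  shows "strongly_resolves (corona G H) w u v \<longleftrightarrow>
    corona_dist D H u w = corona_dist D H u v + corona_dist D H v w \<or>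
    corona_dist D H v w = corona_dist D H v u + corona_dist D H u w"
  using pair_graph.strongly_resolves_iff[OF pair_graph_corona[OF G H] dist_fun_corona[OF D H]]
    assms by blast

text \<open>A geodesic from another copy cannot visit a copy and leave it again, which would cost
  two extra steps. If \<open>w\<close> lies in the copy of one end, the equation forces distance 0
  between \<open>w\<close> and that end.\<close>

lemma pendant_copies_resolved_only_by_ends:
  assumes V: "a \<in> pverts G" "b \<in> pverts G" "h \<in> pverts H" "k \<in> pverts H" "a \<noteq> b"
    and w: "w \<in> pverts (corona G H)" "strongly_resolves (corona G H) w (Inr (a, h)) (Inr (b, k))"
  shows "w = Inr (a, h) \<or> w = Inr (b, k)"
proof -
  let ?d = "corona_dist D H" and ?u = "Inr (a, h)" and ?v = "Inr (b, k)"
  have eq: "?d ?u w = ?d ?u ?v + ?d ?v w \<or> ?d ?v w = ?d ?v ?u + ?d ?u w"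
    using strongly_resolves_corona_iff[of ?u ?v w] V w by simp
  have triangle: "D a c \<le> D a b + D b c" "D b c \<le> D b a + D a c" if "c \<in> pverts G" for c
    using pair_graph.dist_fun_triangle[OF G D] V that by auto
  show ?thesis
    using w(1)
  proof (cases rule: corona_vert_cases)
    case (1 c)
    then show ?thesis using eq triangle[of c] V by auto
  next
    case (2 c l)
    consider "c = a" | "c = b" | "c \<noteq> a" "c \<noteq> b" by blast
    then show ?thesis
    proof cases
      case 3
      then show ?thesis using eq triangle[of c] V 2 by auto
    qed (use eq V 2 in \<open>auto simp: capped_dist_def split: if_splits\<close>)
  qed
qed

text \<open>Two different copies cannot both miss a vertex, so \<open>S\<close> contains all copies
  but one. In that copy only its own vertices can resolve pairs, so the trace \<open>T\<close> of
  \<open>S\<close> covers the conflicts.\<close>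

lemma corona_resolver_subset:
  assumes S: "strong_resolving_set (corona G H) S" and ne: "pverts G \<noteq> {}"
  shows "\<exists>g\<in>pverts G. \<exists>T. conflict_cover H T \<and> corona_resolver G H g T \<subseteq> S"
proof -
  have sub: "S \<subseteq> pverts (corona G H)" using S by (simp add: strong_resolving_set_def)
  have res: "\<exists>w\<in>S. strongly_resolves (corona G H) w u v"
    if "u \<in> pverts (corona G H)" "v \<in> pverts (corona G H)" "u \<noteq> v" for u v
    using S that unfolding strong_resolving_set_def by blast
  have copies: "Inr (a, h) \<in> S \<or> Inr (b, k) \<in> S"
    if V: "a \<in> pverts G" "b \<in> pverts G" "h \<in> pverts H" "k \<in> pverts H" "a \<noteq> b" for a b h k
  proof -
    obtain w where w: "w \<in> S" "strongly_resolves (corona G H) w (Inr (a, h)) (Inr (b, k))"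
      using res[of "Inr (a, h)" "Inr (b, k)"] V by auto
    then have "w = Inr (a, h) \<or> w = Inr (b, k)"
      using pendant_copies_resolved_only_by_ends[OF V _ w(2)] sub by blast
    then show ?thesis using w(1) by blast
  qed
  have "\<exists>g\<in>pverts G. \<forall>a\<in>pverts G. \<forall>h\<in>pverts H. a \<noteq> g \<longrightarrow> Inr (a, h) \<in> S"
  proof (rule ccontr)
    assume none: "\<not> ?thesis"
    \<comment> \<open>An arbitrary \<open>g\<close> fails and yields an incomplete copy at
      \<open>a\<close>; then \<open>a\<close> fails too and yields a second one at \<open>b\<close>,
      against \<open>copies\<close>.\<close>
    obtain g where g: "g \<in> pverts G" using ne by blast
    then obtain a h where a: "a \<in> pverts G" "h \<in> pverts H" "Inr (a, h) \<notin> S"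
      using none by blast
    then obtain b k where "b \<in> pverts G" "k \<in> pverts H" "b \<noteq> a" "Inr (b, k) \<notin> S"
      using none by blast
    then show False using copies a by blast
  qed
  then obtain g where g: "g \<in> pverts G"
    and full: "\<And>a h. a \<in> pverts G \<Longrightarrow> h \<in> pverts H \<Longrightarrow> a \<noteq> g \<Longrightarrow> Inr (a, h) \<in> S"
    by blast
  define T where "T = {h \<in> pverts H. Inr (g, h) \<in> S}"
  have "\<exists>w\<in>T. capped_dist H u w = capped_dist H u v + capped_dist H v w \<or>
               capped_dist H v w = capped_dist H v u + capped_dist H u w"
    if uv: "u \<in> pverts H" "v \<in> pverts H" "u \<noteq> v" for u v
  proof -
    let ?d = "corona_dist D H" and ?u = "Inr (g, u)" and ?v = "Inr (g, v)"
    obtain w where w: "w \<in> S" "strongly_resolves (corona G H) w ?u ?v"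
      using res[of ?u ?v] uv g by auto
    then have eq: "?d ?u w = ?d ?u ?v + ?d ?v w \<or> ?d ?v w = ?d ?v ?u + ?d ?u w"
      using strongly_resolves_corona_iff[of ?u ?v w] uv g sub by auto
    \<comment> \<open>A resolver outside the copy at \<open>g\<close> is equally far from both
      vertices, so the equation would contradict their positive distance.\<close>
    have pos: "0 < capped_dist H u v" "0 < capped_dist H v u"
      using uv by (simp_all add: capped_dist_def)
    have "w \<in> pverts (corona G H)" using w(1) sub by blast
    then show ?thesis
    proof (cases rule: corona_vert_cases)
      case (1 c)
      then show ?thesis using eq pos by simp
    next
      case (2 c l)
      show ?thesis
      proof (cases "c = g")
        case True
        then have "l \<in> T" using 2 w(1) by (simp add: T_def)
        then show ?thesis using eq 2 True by (intro bexI[of _ l]) simp_all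
      next
        case False
        then show ?thesis using eq pos 2 by simp
      qed
    qed
  qed
  then have "conflict_cover H T"
    using conflict_cover_iff_capped_dist[OF H, of T] by (auto simp: T_def)
  moreover have "corona_resolver G H g T \<subseteq> S"
    using full by (auto simp: corona_resolver_def T_def)
  ultimately show ?thesis using g by blast
qed

text \<open>The second vertex \<open>c\<close> serves to resolve \<open>g\<close> from its own
  pendant vertices: these reach the copy at \<open>c\<close> only through \<open>g\<close>.\<close>

lemma strong_resolving_set_corona_resolver:
  assumes T: "conflict_cover H T" and g: "g \<in> pverts G" and c: "c \<in> pverts G" "c \<noteq> g"
    and ne: "pverts H \<noteq> {}"
  shows "strong_resolving_set (corona G H) (corona_resolver G H g T)"
proof -
  let ?X = "corona G H" and ?S = "corona_resolver G H g T" and ?d = "corona_dist D H"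
  have T_sub: "T \<subseteq> pverts H" using T by (simp add: conflict_cover_def)
  then have sub: "?S \<subseteq> pverts ?X" using g by (auto simp: corona_resolver_def)
  obtain h0 where h0: "h0 \<in> pverts H" using ne by blast
  have mem: "Inr (a, h) \<in> ?S" if "a \<in> pverts G" "a \<noteq> g" "h \<in> pverts H" for a h
    using that by (auto simp: corona_resolver_def)
  have memT: "Inr (g, h) \<in> ?S" if "h \<in> T" for h
    using that by (auto simp: corona_resolver_def)
  have D0: "D a a = 0" if "a \<in> pverts G" for a using dist_fun_refl[OF D that] .
  have resolvedI: "\<exists>w\<in>?S. strongly_resolves ?X w u v"
    if "u \<in> pverts ?X" "v \<in> pverts ?X" "w \<in> ?S"
      "?d u w = ?d u v + ?d v w \<or> ?d v w = ?d v u + ?d u w" for u v w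
    using strongly_resolves_corona_iff[of u v w] that sub by blast
  have sym: "(\<exists>w\<in>?S. strongly_resolves ?X w u v) \<longleftrightarrow> (\<exists>w\<in>?S. strongly_resolves ?X w v u)" for u v
    unfolding strongly_resolves_def by blast
  have self: "\<exists>w\<in>?S. strongly_resolves ?X w u v"
    if "u \<in> pverts ?X" "v \<in> pverts ?X" "u \<in> ?S" for u v
    using resolvedI[OF that(1,2,3)] dist_fun_refl[OF dist_fun_corona[OF D H] that(1)] by simp
  \<comment> \<open>The way from \<open>Inl a\<close> to a pendant vertex behind \<open>b\<close>
    passes \<open>Inl b\<close>.\<close>
  have GG: "\<exists>w\<in>?S. strongly_resolves ?X w (Inl a) (Inl b)"
    if "a \<in> pverts G" "b \<in> pverts G" "b \<noteq> g" for a b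
    by (rule resolvedI[of _ _ "Inr (b, h0)"]) (use that h0 D0 mem in auto)
  have GH: "\<exists>w\<in>?S. strongly_resolves ?X w (Inl a) (Inr (b, h))"
    if V: "a \<in> pverts G" "b \<in> pverts G" "h \<in> pverts H" for a b h
  proof (cases "b = g")
    case False
    then show ?thesis using self[of "Inr (b, h)" "Inl a"] sym mem V by simp
  next
    case True
    \<comment> \<open>The route from \<open>Inr (g, h)\<close> to a pendant vertex at
      \<open>c'\<close> passes \<open>Inl a\<close>, either on leaving the copy at \<open>g\<close>
      or on entering the copy at \<open>a\<close>.\<close>
    define c' where "c' = (if a = g then c else a)"
    have "c' \<in> pverts G" "c' \<noteq> g" "a = g \<or> a = c'" using c V by (auto simp: c'_def)
    then show ?thesis
      using V True h0 D0 mem by (intro resolvedI[of _ _ "Inr (c', h0)"]) auto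
  qed
  have HH: "\<exists>w\<in>?S. strongly_resolves ?X w (Inr (a, h)) (Inr (b, k))"
    if V: "a \<in> pverts G" "b \<in> pverts G" "h \<in> pverts H" "k \<in> pverts H" "(a, h) \<noteq> (b, k)"
    for a b h k
  proof -
    consider "a \<noteq> g" | "b \<noteq> g" | "a = g" "b = g" by blast
    then show ?thesis
    proof cases
      case 1
      then show ?thesis using self mem V by simp
    next
      case 2
      then show ?thesis using self[of "Inr (b, k)" "Inr (a, h)"] sym mem V by simp
    next
      case 3
      then obtain l where "l \<in> T"
        "capped_dist H h l = capped_dist H h k + capped_dist H k l \<or>
         capped_dist H k l = capped_dist H k h + capped_dist H h l"
        using T conflict_cover_iff_capped_dist[OF H T_sub] V by blast
      then show ?thesis
        using V 3 memT by (intro resolvedI[of _ _ "Inr (g, l)"]) simp_all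
    qed
  qed
  show ?thesis
    unfolding strong_resolving_set_def
  proof (intro conjI ballI impI sub)
    fix u v assume u: "u \<in> pverts ?X" and v: "v \<in> pverts ?X" and uv: "u \<noteq> v"
    show "\<exists>w\<in>?S. strongly_resolves ?X w u v"
      using u
    proof (cases rule: corona_vert_cases)
      case u: (1 a)
      show ?thesis
        using v
      proof (cases rule: corona_vert_cases)
        case (1 b)
        \<comment> \<open>One of the distinct vertices \<open>a\<close>, \<open>b\<close> differs
          from \<open>g\<close>, as \<open>GG\<close> demands of its second vertex.\<close>
        then show ?thesis using GG[of a b] GG[of b a] sym[of u v] u uv by auto
      next
        case (2 b h)
        then show ?thesis using GH u by simp
      qed
    next
      case u: (2 a h)
      show ?thesis
        using v
      proof (cases rule: corona_vert_cases)
        case (1 b)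
        then show ?thesis using GH[of b a h] sym[of u v] u by simp
      next
        case (2 b k)
        then show ?thesis using HH u uv by simp
      qed
    qed
  qed
qed

text \<open>The resolver over a minimum cover attains the value, and every strong resolving set
  contains some resolver over a cover. Only capped distances of \<open>H\<close> enter, so
  \<open>H\<close> may be disconnected.\<close>

lemma strong_metric_dim_corona:
  assumes card: "2 \<le> card (pverts G)" and ne: "pverts H \<noteq> {}"
  shows "strong_metric_dim (corona G H) = (card (pverts G) - 1) * card (pverts H) + cover_number H"
    (is "_ = ?n")
  unfolding strong_metric_dim_def
proof (rule Least_equality)
  have fin: "finite (pverts G)" using G by (simp add: pair_graph_altdef)
  obtain g where g: "g \<in> pverts G" using card by fastforce
  have "card (pverts G - {g}) \<noteq> 0" using card g fin by simp
  then have "pverts G - {g} \<noteq> {}" by (metis card.empty)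
  then obtain c where c: "c \<in> pverts G" "c \<noteq> g" by blast
  obtain T where T: "conflict_cover H T" "card T = cover_number H"
    using cover_number_attained by blast
  then have "card (corona_resolver G H g T) = ?n"
    using card_corona_resolver[OF G H g] by (simp add: conflict_cover_def)
  then show "\<exists>S. strong_resolving_set (corona G H) S \<and> card S = ?n"
    using strong_resolving_set_corona_resolver[OF T(1) g c ne] by blast
next
  fix k assume "\<exists>S. strong_resolving_set (corona G H) S \<and> card S = k"
  then obtain S where S: "strong_resolving_set (corona G H) S" "card S = k" by blast
  have "pverts G \<noteq> {}" using card by auto
  then obtain g T where g: "g \<in> pverts G" and T: "conflict_cover H T" "corona_resolver G H g T \<subseteq> S"
    using corona_resolver_subset[OF S(1)] by blast
  have "finite S"
    by (rule finite_subset[of _ "pverts (corona G H)"])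
      (use S(1) pair_graph_corona[OF G H] in \<open>simp_all add: strong_resolving_set_def pair_graph_altdef\<close>)
  then have "card (corona_resolver G H g T) \<le> k" using T(2) S(2) card_mono by blast
  moreover have "card (corona_resolver G H g T) = (card (pverts G) - 1) * card (pverts H) + card T"
    using card_corona_resolver[OF G H g] T(1) by (simp add: conflict_cover_def)
  ultimately show "?n \<le> k" using cover_number_le[OF T(1)] by simp
qed

end

section \<open>Corona products over a single vertex\<close>

lemma universal_extension_corona:
  assumes "pair_graph G" "pair_graph H" "pverts G = {g}"
  shows "universal_extension H (corona G H) (\<lambda>h. Inr (g, h)) (Inl g)"
proof (rule universal_extension.intro)
  show "pair_graph (corona G H)" using assms by (intro pair_graph_corona)
  show "pverts (corona G H) = insert (Inl g) ((\<lambda>h. Inr (g, h)) ` pverts H)"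
    using assms by (auto simp: corona_def)
qed (use assms in \<open>auto simp: inj_on_def\<close>)

text \<open>There is no second copy to resolve \<open>g\<close> from its pendant vertices, but
  \<open>g\<close> is universal and so the diameter is at most two.\<close>

lemma strong_metric_dim_corona_single:
  assumes "pair_graph G" "pair_graph H" "pverts G = {g}" and "\<And>a. \<not> universal H a"
  shows "strong_metric_dim (corona G H) = cover_number H"
proof -
  interpret universal_extension H "corona G H" "\<lambda>h. Inr (g, h)" "Inl g"
    using assms(1-3) by (rule universal_extension_corona)
  show ?thesis
    using strong_metric_dim_eq_cover_number[OF X universal_imp_diameter_le_two[OF X universal_apex]]
      cover_number_no_universal[OF assms(4)] by simp
qed

section \<open>Maximum degree and diameter\<close>

text \<open>Without loops the neighbourhood \<open>N\<close> lies in the set of the other vertices.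
  This bounds the degree, and equality of these finite sets shows in their cardinalities.\<close>

lemma
  assumes X: "pair_graph X" and a: "a \<in> pverts X"
  shows out_degree_le: "out_degree (with_proj X) a \<le> card (pverts X) - 1"
    and universal_iff_out_degree: "universal X a \<longleftrightarrow> out_degree (with_proj X) a = card (pverts X) - 1"
proof -
  define N where "N = {v. (a, v) \<in> parcs X}"
  have fin: "finite (pverts X)" using X by (simp add: pair_graph_altdef)
  have "out_arcs (with_proj X) a = Pair a ` N" by (auto simp: out_arcs_def N_def)
  then have deg: "out_degree (with_proj X) a = card N"
    by (simp add: out_degree_def card_image inj_on_def)
  have sub: "N \<subseteq> pverts X - {a}"
    using X pair_graph_no_loop[OF X] by (auto simp: pair_graph_altdef N_def)
  have card: "card (pverts X - {a}) = card (pverts X) - 1" using a fin by simp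
  show "out_degree (with_proj X) a \<le> card (pverts X) - 1"
    using card_mono[OF _ sub] fin deg card by simp
  have "universal X a \<longleftrightarrow> N = pverts X - {a}"
    using sub a by (auto simp: universal_def N_def)
  also have "\<dots> \<longleftrightarrow> card N = card (pverts X - {a})"
  proof
    assume "card N = card (pverts X - {a})"
    then show "N = pverts X - {a}" using fin by (intro card_subset_eq sub) simp
  qed simp
  finally show "universal X a \<longleftrightarrow> out_degree (with_proj X) a = card (pverts X) - 1"
    unfolding deg card .
qed

lemma max_degree_eq_iff_universal:
  assumes X: "pair_graph X" and ne: "pverts X \<noteq> {}"
  shows "max_degree X = card (pverts X) - 1 \<longleftrightarrow> (\<exists>a. universal X a)"
proof
  let ?A = "out_degree (with_proj X) ` pverts X"
  have A: "finite ?A" "?A \<noteq> {}" using X ne by (simp_all add: pair_graph_altdef)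
  {
    assume "max_degree X = card (pverts X) - 1"
    then have "card (pverts X) - 1 \<in> ?A" using Max_in[OF A] by (simp add: max_degree_def)
    then obtain a where "a \<in> pverts X" "out_degree (with_proj X) a = card (pverts X) - 1" by force
    then show "\<exists>a. universal X a" using universal_iff_out_degree[OF X] by blast
  next
    assume "\<exists>a. universal X a"
    then obtain a where a: "a \<in> pverts X" "universal X a" by (auto simp: universal_def)
    then have "card (pverts X) - 1 = out_degree (with_proj X) a"
      using universal_iff_out_degree[OF X] by simp
    then have "card (pverts X) - 1 \<in> ?A" using a(1) by (rule image_eqI)
    moreover have "k \<le> card (pverts X) - 1" if "k \<in> ?A" for k
      using that out_degree_le[OF X] by blast
    ultimately show "max_degree X = card (pverts X) - 1"
      unfolding max_degree_def using A(1) by (intro Max_eqI)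
  }
qed

section \<open>Diameter, connectedness and universal vertices\<close>

lemma graph_diameter_imp_diameter_le_two:
  assumes X: "pair_graph X" and diam: "graph_diameter X \<le> 2"
  shows "diameter_le_two X"
  unfolding diameter_le_two_def
proof (intro ballI impI)
  interpret pair_graph X by (rule X)
  fix u v assume uv: "u \<in> pverts X" "v \<in> pverts X" "u \<noteq> v" "(u, v) \<notin> parcs X"
  have "graph_dist X u v \<le> graph_diameter X"
    unfolding graph_diameter_def using uv by (intro SUP_upper2[of u] SUP_upper2[of v]) auto
  then have le: "\<mu> (\<lambda>_. 1) u v \<le> 2" using diam by (simp add: graph_dist_def)
  \<comment> \<open>Distances are extended reals: the bound first gives finiteness, hence a path
    that attains the distance.\<close>
  also have "(2 :: ereal) < \<infinity>" by simp
  finally obtain p where p: "apath u p v" "\<mu> (\<lambda>_. 1) u v = ereal (awalk_cost (\<lambda>_. 1) p)"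
    using min_cost_awalk[of u v "\<lambda>_. 1"] unfolding \<mu>_reach_conv by force
  then have walk: "awalk u p v" by (simp add: apath_def)
  have "ereal (real (length p)) \<le> ereal 2" using le p(2) by (simp add: awalk_cost_one)
  then have "length p = 0 \<or> length p = 1 \<or> length p = 2" unfolding ereal_less_eq by linarith
  then consider "p = []" | e where "p = [e]" | e e' where "p = [e, e']"
    by (auto simp: length_Suc_conv numeral_2_eq_2)
  then show "\<exists>x. (u, x) \<in> parcs X \<and> (x, v) \<in> parcs X"
  proof cases
    case (3 e e')
    then have "(u, snd e) \<in> parcs X" "(snd e, v) \<in> parcs X"
      using walk by (cases e; cases e'; simp add: awalk_simps)+
    then show ?thesis by blast
  next
    case (2 e)
    then show ?thesis using walk uv by (cases e) (simp add: awalk_simps)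
  qed (use walk uv in \<open>simp add: awalk_Nil_iff\<close>)
qed

text \<open>Used with the next lemma in contrapositive form: a graph that is disconnected or of
  diameter above two has no universal vertex.\<close>

lemma universal_imp_connected:
  assumes X: "pair_graph X" and "universal X a"
  shows "Digraph_Component.connected (with_proj X)"
proof (rule pair_graph.dist_fun_imp_connected[OF X dist_fun_capped_dist[OF X]])
  show "diameter_le_two X" using assms by (rule universal_imp_diameter_le_two)
  show "pverts X \<noteq> {}" using assms(2) by (auto simp: universal_def)
qed

lemma universal_imp_graph_diameter_le:
  assumes X: "pair_graph X" and "universal X a"
  shows "graph_diameter X \<le> 2"
  unfolding graph_diameter_def
proof (intro SUP_least)
  fix u v assume "u \<in> pverts X" "v \<in> pverts X"
  then have "graph_dist X u v = ereal (real (capped_dist X u v))"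
    using pair_graph.graph_dist_eq_dist_fun[OF X dist_fun_capped_dist[OF X]]
      universal_imp_diameter_le_two[OF assms] by blast
  then show "graph_dist X u v \<le> 2" by (simp add: capped_dist_def)
qed

theorem theorem10:
  fixes G :: "'a pair_pre_digraph" and H :: "'b pair_pre_digraph"
    and n1 n2 \<Delta> :: nat
  assumes "pair_graph G" and "Digraph_Component.connected (with_proj G)"
    and "card (pverts G) = n1"
    and "pair_graph H" and "pverts H \<noteq> {}"
    and "card (pverts H) = n2" and "max_degree H = \<Delta>"
  shows
    "(\<Delta> = n2 - 1 \<longrightarrow>
        strong_metric_dim (graph_join K1 H) = strong_metric_dim H + 1) \<and>
     (graph_diameter H = 2 \<and> (\<Delta> + 2 \<le> n2 \<or> n1 \<ge> 2) \<longrightarrow>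
        strong_metric_dim (corona G H) = (n1 - 1) * n2 + strong_metric_dim H) \<and>
     (\<not> Digraph_Component.connected (with_proj H) \<or> graph_diameter H > 2 \<longrightarrow>
        strong_metric_dim (corona G H) = (n1 - 1) * n2 + strong_metric_dim (graph_join K1 H))"
proof (intro conjI impI)
  note G = assms(1) and H = assms(4) and ne = assms(5)
  interpret universal_extension H "graph_join K1 H" Inr "Inl ()"
    using H by (rule universal_extension_join)
  have universal: "\<Delta> = n2 - 1 \<longleftrightarrow> (\<exists>a. universal H a)"
    using max_degree_eq_iff_universal[OF H ne] assms(6,7) by simp
  \<comment> \<open>One formula serves both claims on corona products. For \<open>n1 = 1\<close> the
    product is \<open>K1 + H\<close>, and the absence of universal vertices in \<open>H\<close>
    keeps the cover number.\<close>
  have corona: "strong_metric_dim (corona G H) = (n1 - 1) * n2 + cover_number H"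
    if "n1 \<ge> 2 \<or> \<not> (\<exists>a. universal H a)"
  proof (cases "n1 \<ge> 2")
    case True
    obtain D where "dist_fun G D"
      using pair_graph.connected_imp_dist_fun[OF G assms(2)] by blast
    then show ?thesis using strong_metric_dim_corona[OF G H _ _ ne] True assms(3,6) by simp
  next
    case False
    have "pverts G \<noteq> {}" "finite (pverts G)"
      using pair_graph.connected_iff[OF G] assms(1,2) by (auto simp: pair_graph_altdef)
    then have "n1 = 1" using False assms(3) by (auto simp: not_le less_2_cases_iff)
    moreover from this obtain g where "pverts G = {g}" using assms(3) card_1_singletonE by blast
    ultimately show ?thesis
      using strong_metric_dim_corona_single[OF G H] False that by simp
  qed
  {
    assume "\<Delta> = n2 - 1"
    then obtain a where a: "universal H a" using universal by blast
    then show "strong_metric_dim (graph_join K1 H) = strong_metric_dim H + 1"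
      using strong_metric_dim_join[OF H] cover_number_universal[OF a]
        strong_metric_dim_eq_cover_number[OF H universal_imp_diameter_le_two[OF H a]] by simp
  next
    assume as: "graph_diameter H = 2 \<and> (\<Delta> + 2 \<le> n2 \<or> n1 \<ge> 2)"
    \<comment> \<open>\<open>\<Delta> + 2 \<le> n2\<close> excludes the degree \<open>n2 - 1\<close>
      of a universal vertex.\<close>
    then have "n1 \<ge> 2 \<or> \<Delta> \<noteq> n2 - 1" by auto
    then have "n1 \<ge> 2 \<or> \<not> (\<exists>a. universal H a)" using universal by blast
    then show "strong_metric_dim (corona G H) = (n1 - 1) * n2 + strong_metric_dim H"
      using corona as graph_diameter_imp_diameter_le_two[OF H] strong_metric_dim_eq_cover_number[OF H]
      by simp
  next
    assume "\<not> Digraph_Component.connected (with_proj H) \<or> graph_diameter H > 2"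
    then have none: "\<not> universal H a" for a
      using universal_imp_connected[OF H] universal_imp_graph_diameter_le[OF H] by (metis not_le)
    \<comment> \<open>Without universal vertices the join has cover number
      \<open>cover_number H\<close>, the last summand of \<open>corona\<close>.\<close>
    then show "strong_metric_dim (corona G H) = (n1 - 1) * n2 + strong_metric_dim (graph_join K1 H)"
      using corona cover_number_no_universal[OF none] strong_metric_dim_join[OF H] by simp
  }
qed

end
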